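(* Let $\mathbf{k}$ be a field of characteristic $0$ and let $(A,\mu,\alpha)$ be a Hom-algebra over $\mathbf{k}$. Then $A$ satisfies $x^4=\alpha(x^2)\alpha(x^2)$ for all $x\in A$ if and only if $F(x,y,z,w)=0$ for all $x,y,z,w\in A$, where $F=F_L-F_R$ is the difference of the following two sums: $F_L(x,y,z,w)$ is the sum of the twelve terms obtained from $\left((x\bullet y)\alpha(z)\right)\alpha^2(w)$ by permuting the four variables, and $F_R(x,y,z,w)$ is the sum of the six terms obtained from $\alpha(x\bullet y)\,\alpha(z\bullet w)$ by permuting the four variables.
   Context: A Hom-algebra $(A,\mu,\alpha)$ over $\mathbf{k}$ is a $\mathbf{k}$-vector space $A$ with a bilinear map $\mu\colon A^{\otimes 2}\to A$ (no associativity assumed; write $xy=\mu(x,y)$) and a linear map $\alpha\colon A\to A$ (not assumed multiplicative). Hom-powers: $x^2=xx$, $x^4=((xx)\alpha(x))\alpha^2(x)$, with $\alpha^2=\alpha\circ\alpha$. Notation: $a\bullet b=ab+ba$, which is symmetric in $a,b$. Explicitly, writing $(x_1,x_2,x_3,x_4)=(x,y,z,w)$: $$F_L(x_1,x_2,x_3,x_4)=\sum \left((x_a\bullet x_b)\alpha(x_c)\right)\alpha^2(x_d),$$ summed over the twelve ordered pairs $(c,d)$ of distinct elements of $\{1,2,3,4\}$, where $\{a,b\}=\{1,2,3,4\}\setminus\{c,d\}$; and $$F_R(x_1,x_2,x_3,x_4)=\sum \alpha(x_a\bullet x_b)\,\alpha(x_c\bullet x_d),$$ summed over the six two-element subsets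 $\{a,b\}$ of $\{1,2,3,4\}$, where $\{c,d\}$ is the complement of $\{a,b\}$. *)

theory Defs
  imports Complex_Main
begin

locale hom_algebra = vector_space scale
  for scale :: "'k::field \<Rightarrow> 'a::ab_group_add \<Rightarrow> 'a" +
  fixes mu :: "'a \<Rightarrow> 'a \<Rightarrow> 'a"
    and alpha :: "'a \<Rightarrow> 'a"
  assumes mu_linear_right: "\<And>x. Vector_Spaces.linear scale scale (\<lambda>y. mu x y)"
    and mu_linear_left: "\<And>y. Vector_Spaces.linear scale scale (\<lambda>x. mu x y)"
    and alpha_linear: "Vector_Spaces.linear scale scale alpha"

definition hom_pow2 :: "('a \<Rightarrow> 'a \<Rightarrow> 'a) \<Rightarrow> 'a \<Rightarrow> 'a" where
  "hom_pow2 mu x = mu x x"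

definition hom_pow4 :: "('a \<Rightarrow> 'a \<Rightarrow> 'a) \<Rightarrow> ('a \<Rightarrow> 'a) \<Rightarrow> 'a \<Rightarrow> 'a" where
  "hom_pow4 mu alpha x = mu (mu (mu x x) (alpha x)) ((alpha ^^ 2) x)"

definition bullet :: "('a::plus \<Rightarrow> 'a \<Rightarrow> 'a) \<Rightarrow> 'a \<Rightarrow> 'a \<Rightarrow> 'a" where
  "bullet mu a b = mu a b + mu b a"

text \<open>The value at a two-element index set \<open>{a, b}\<close> is \<open>x\<^sub>a \<bullet> x\<^sub>b\<close>.
  Since the bullet product is symmetric, reading off the two elements as minimum and maximum
  involves no choice.\<close>

definition bullet_on ::
  "('a::plus \<Rightarrow> 'a \<Rightarrow> 'a) \<Rightarrow> (nat \<Rightarrow> 'a) \<Rightarrow> nat set \<Rightarrow> 'a" where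
  "bullet_on mu v S = bullet mu (v (Min S)) (v (Max S))"

lemma bullet_on_pair:
  fixes mu :: "'a::ab_semigroup_add \<Rightarrow> 'a \<Rightarrow> 'a"
  shows "bullet_on mu v {a, b} = bullet mu (v a) (v b)"
  by (cases "a \<le> b") (auto simp: bullet_on_def bullet_def min_def max_def add.commute)

text \<open>The four variables are numbered from 1.\<close>

definition four :: "'a \<Rightarrow> 'a \<Rightarrow> 'a \<Rightarrow> 'a \<Rightarrow> nat \<Rightarrow> 'a" where
  "four x y z w i = [x, y, z, w] ! (i - 1)"

definition F_L :: "('a::ab_group_add \<Rightarrow> 'a \<Rightarrow> 'a) \<Rightarrow> ('a \<Rightarrow> 'a) \<Rightarrow>
    'a \<Rightarrow> 'a \<Rightarrow> 'a \<Rightarrow> 'a \<Rightarrow> 'a" where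
  "F_L mu alpha x y z w = (let v = four x y z w in
     \<Sum>(c, d) \<in> {(c, d). c \<in> {1..4} \<and> d \<in> {1..4} \<and> c \<noteq> d}.
       mu (mu (bullet_on mu v ({1..4} - {c, d})) (alpha (v c))) ((alpha ^^ 2) (v d)))"

definition F_R :: "('a::ab_group_add \<Rightarrow> 'a \<Rightarrow> 'a) \<Rightarrow> ('a \<Rightarrow> 'a) \<Rightarrow>
    'a \<Rightarrow> 'a \<Rightarrow> 'a \<Rightarrow> 'a \<Rightarrow> 'a" where
  "F_R mu alpha x y z w = (let v = four x y z w in
     \<Sum>S \<in> {S. S \<subseteq> {1..4} \<and> card S = 2}.
       mu (alpha (bullet_on mu v S)) (alpha (bullet_on mu v ({1..4} - S))))"

definition F :: "('a::ab_group_add \<Rightarrow> 'a \<Rightarrow> 'a) \<Rightarrow> ('a \<Rightarrow> 'a) \<Rightarrow>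
    'a \<Rightarrow> 'a \<Rightarrow> 'a \<Rightarrow> 'a \<Rightarrow> 'a" where
  "F mu alpha x y z w = F_L mu alpha x y z w - F_R mu alpha x y z w"

lemma atLeastAtMost_1_4: "{1..4} = {1, 2, 3, 4::nat}"
  by (rule set_eqI, unfold atLeastAtMost_iff insert_iff empty_iff) presburger

lemma F_L_expand:
  fixes mu :: "'a::ab_group_add \<Rightarrow> 'a \<Rightarrow> 'a" and alpha :: "'a \<Rightarrow> 'a"
  defines "t \<equiv> \<lambda>a b c d. mu (mu (bullet mu a b) (alpha c)) ((alpha ^^ 2) d)"
  shows "F_L mu alpha x y z w =
      t z w x y + t y w x z + t y z x w + t z w y x + t x w y z + t x z y w
    + t y w z x + t x w z y + t x y z w + t y z w x + t x z w y + t x y w z"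
proof -
  have pairs: "{(c, d). c \<in> {1..4::nat} \<and> d \<in> {1..4} \<and> c \<noteq> d} =
      set [(1,2),(1,3),(1,4),(2,1),(2,3),(2,4),(3,1),(3,2),(3,4),(4,1),(4,2),(4,3)]"
    unfolding atLeastAtMost_1_4 by auto
  have compl: "{1..4} - {1,2} = {3,4::nat}" "{1..4} - {1,3} = {2,4::nat}"
    "{1..4} - {1,4} = {2,3::nat}" "{1..4} - {2,1} = {3,4::nat}"
    "{1..4} - {2,3} = {1,4::nat}" "{1..4} - {2,4} = {1,3::nat}"
    "{1..4} - {3,1} = {2,4::nat}" "{1..4} - {3,2} = {1,4::nat}"
    "{1..4} - {3,4} = {1,2::nat}" "{1..4} - {4,1} = {2,3::nat}"
    "{1..4} - {4,2} = {1,3::nat}" "{1..4} - {4,3} = {1,2::nat}"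
    unfolding atLeastAtMost_1_4 by auto
  have v: "four x y z w 1 = x" "four x y z w 2 = y" "four x y z w 3 = z" "four x y z w 4 = w"
    by (simp_all add: four_def)
  show ?thesis
    unfolding F_L_def Let_def pairs t_def
    by (subst sum.distinct_set_conv_list, simp)
      (simp only: list.map sum_list.Cons sum_list.Nil prod.case compl bullet_on_pair v
        add_0_right add.assoc)
qed

lemma F_R_expand:
  fixes mu :: "'a::ab_group_add \<Rightarrow> 'a \<Rightarrow> 'a" and alpha :: "'a \<Rightarrow> 'a"
  defines "t \<equiv> \<lambda>a b c d. mu (alpha (bullet mu a b)) (alpha (bullet mu c d))"
  shows "F_R mu alpha x y z w =
      t x y z w + t x z y w + t x w y z + t y z x w + t y w x z + t z w x y"
proof -
  have "S \<in> set [{1,2},{1,3},{1,4},{2,3},{2,4},{3,4}]"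
    if sub: "S \<subseteq> {1..4}" and card: "card S = 2" for S :: "nat set"
  proof -
    from card obtain a b where S: "S = {a, b}" and ab: "a \<noteq> b"
      by (auto simp: card_2_iff)
    have a: "a = 1 \<or> a = 2 \<or> a = 3 \<or> a = 4" and b: "b = 1 \<or> b = 2 \<or> b = 3 \<or> b = 4"
      using sub by (simp_all only: S atLeastAtMost_1_4 insert_subset insert_iff empty_iff simp_thms)
    show ?thesis
      unfolding S using ab a b by (elim disjE) (simp_all add: insert_commute)
  qed
  moreover have "S \<subseteq> {1..4} \<and> card S = 2"
    if "S \<in> set [{1,2},{1,3},{1,4},{2,3},{2,4},{3,4}]" for S :: "nat set"
    using that unfolding list.set insert_iff empty_iff by (elim disjE) simp_all
  ultimately have subs: "{S. S \<subseteq> {1..4::nat} \<and> card S = 2} =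
      set [{1,2},{1,3},{1,4},{2,3},{2,4},{3,4}]"
    by (intro set_eqI iffI CollectI) (simp_all only: mem_Collect_eq)
  have compl: "{1..4} - {1,2} = {3,4::nat}" "{1..4} - {1,3} = {2,4::nat}"
    "{1..4} - {1,4} = {2,3::nat}" "{1..4} - {2,3} = {1,4::nat}"
    "{1..4} - {2,4} = {1,3::nat}" "{1..4} - {3,4} = {1,2::nat}"
    unfolding atLeastAtMost_1_4 by auto
  have v: "four x y z w 1 = x" "four x y z w 2 = y" "four x y z w 3 = z" "four x y z w 4 = w"
    by (simp_all add: four_def)
  have dist: "distinct [{1,2},{1,3},{1,4},{2,3},{2,4},{3,4::nat}]"
    by (simp add: doubleton_eq_iff)
  show ?thesis
    unfolding F_R_def Let_def subs t_def sum.distinct_set_conv_list[OF dist]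
    by (simp only: list.map sum_list.Cons sum_list.Nil compl bullet_on_pair v
        add_0_right add.assoc)
qed

end

theory Submission
  imports Defs
begin

text \<open>
  The identity \<open>x\<^sup>4 = \<alpha>(x\<^sup>2) \<alpha>(x\<^sup>2)\<close> says that the four-linear map
  \<open>g(a, b, c, d) = ((a b) \<alpha>(c)) \<alpha>\<^sup>2(d) - \<alpha>(a b) \<alpha>(c d)\<close> vanishes on the diagonal, and \<open>F\<close> is
  nothing but the sum of \<open>g\<close> over all \<open>24\<close> orderings of its arguments: writing out the bullet
  products turns each of the twelve terms of \<open>F_L\<close> into two words and each of the six terms of
  \<open>F_R\<close> into four (\<open>F_eq_symmetrization4\<close>).

  The equivalence is therefore the polarization principle for quartic forms. By inclusion-exclusion
  the symmetrization is an alternating sum of diagonal values (\<open>polarization4\<close>), so it vanishes if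
  they do; conversely its value at \<open>(x, x, x, x)\<close> is \<open>24\<close> times the diagonal value at \<open>x\<close>, and
  \<open>24\<close> is invertible in characteristic \<open>0\<close>.
\<close>

definition symmetrization4 ::
  "('a \<Rightarrow> 'a \<Rightarrow> 'a \<Rightarrow> 'a \<Rightarrow> 'b::ab_group_add) \<Rightarrow> 'a \<Rightarrow> 'a \<Rightarrow> 'a \<Rightarrow> 'a \<Rightarrow> 'b" where
  "symmetrization4 g x y z w =
      g x y z w + g x y w z + g x z y w + g x z w y + g x w y z + g x w z y
    + g y x z w + g y x w z + g y z x w + g y z w x + g y w x z + g y w z x
    + g z x y w + g z x w y + g z y x w + g z y w x + g z w x y + g z w y x
    + g w x y z + g w x z y + g w y x z + g w y z x + g w z x y + g w z y x"

text \<open>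
  Additivity makes \<open>p\<close> at a sum of variables the sum of \<open>g\<close> over all words of length four in these
  variables. The alternating sum over the nonempty subsets of the variables keeps exactly the words
  in which every variable occurs, and a word of length four with four letters is a permutation.
\<close>

lemma polarization4:
  fixes g :: "'a::ab_group_add \<Rightarrow> 'a \<Rightarrow> 'a \<Rightarrow> 'a \<Rightarrow> 'b::ab_group_add"
  assumes additive:
    "\<And>a a' b c d. g (a + a') b c d = g a b c d + g a' b c d"
    "\<And>a b b' c d. g a (b + b') c d = g a b c d + g a b' c d"
    "\<And>a b c c' d. g a b (c + c') d = g a b c d + g a b c' d"
    "\<And>a b c d d'. g a b c (d + d') = g a b c d + g a b c d'"
  defines "p \<equiv> \<lambda>x. g x x x x"
  shows "symmetrization4 g x y z w = p (x + y + z + w)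
     - p (x + y + z) - p (x + y + w) - p (x + z + w) - p (y + z + w)
     + p (x + y) + p (x + z) + p (x + w) + p (y + z) + p (y + w) + p (z + w)
     - p x - p y - p z - p w"
  unfolding p_def symmetrization4_def additive by (simp add: algebra_simps)

lemma (in vector_space) symmetrization4_diagonal:
  "symmetrization4 g x x x x = scale 24 (g x x x x)"
proof -
  have "scale 24 (g x x x x) = (\<Sum>i<24::nat. g x x x x)"
    by (simp only: sum_constant_scale card_lessThan of_nat_numeral)
  also have "\<dots> = symmetrization4 g x x x x"
    by (simp add: lessThan_nat_numeral symmetrization4_def add.assoc)
  finally show ?thesis ..
qed

context hom_algebra
begin

lemma mu_add_right: "mu a (b + c) = mu a b + mu a c"
  using mu_linear_right by (simp add: Vector_Spaces.linear_iff)

lemma mu_add_left: "mu (a + b) c = mu a c + mu b c"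
  using mu_linear_left by (simp add: Vector_Spaces.linear_iff)

lemma alpha_add: "alpha (a + b) = alpha a + alpha b"
  using alpha_linear by (simp add: Vector_Spaces.linear_iff)

definition quartic_defect :: "'a \<Rightarrow> 'a \<Rightarrow> 'a \<Rightarrow> 'a \<Rightarrow> 'a" where
  "quartic_defect a b c d =
    mu (mu (mu a b) (alpha c)) ((alpha ^^ 2) d) - mu (alpha (mu a b)) (alpha (mu c d))"

lemma quartic_defect_additive:
  "quartic_defect (a + a') b c d = quartic_defect a b c d + quartic_defect a' b c d"
  "quartic_defect a (b + b') c d = quartic_defect a b c d + quartic_defect a b' c d"
  "quartic_defect a b (c + c') d = quartic_defect a b c d + quartic_defect a b c' d"
  "quartic_defect a b c (d + d') = quartic_defect a b c d + quartic_defect a b c d'"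
  by (simp_all add: quartic_defect_def numeral_2_eq_2 mu_add_left mu_add_right alpha_add)

lemma quartic_defect_diagonal:
  "quartic_defect x x x x = 0 \<longleftrightarrow>
    hom_pow4 mu alpha x = mu (alpha (hom_pow2 mu x)) (alpha (hom_pow2 mu x))"
  by (simp add: quartic_defect_def hom_pow4_def hom_pow2_def)

lemma F_eq_symmetrization4: "F mu alpha x y z w = symmetrization4 quartic_defect x y z w"
  unfolding F_def F_L_expand F_R_expand symmetrization4_def quartic_defect_def
  by (simp add: bullet_def mu_add_left mu_add_right alpha_add algebra_simps)

end

theorem theorem4p8:
  fixes scale :: "'k::field_char_0 \<Rightarrow> 'a::ab_group_add \<Rightarrow> 'a"
    and mu :: "'a \<Rightarrow> 'a \<Rightarrow> 'a"
    and alpha :: "'a \<Rightarrow> 'a"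
  assumes "hom_algebra scale mu alpha"
  shows "(\<forall>x. hom_pow4 mu alpha x = mu (alpha (hom_pow2 mu x)) (alpha (hom_pow2 mu x)))
    \<longleftrightarrow> (\<forall>x y z w. F mu alpha x y z w = 0)"
proof -
  interpret hom_algebra scale mu alpha by fact
  have "(\<forall>x. quartic_defect x x x x = 0) \<longleftrightarrow> (\<forall>x y z w. F mu alpha x y z w = 0)"
  proof
    assume "\<forall>x. quartic_defect x x x x = 0"
    then show "\<forall>x y z w. F mu alpha x y z w = 0"
      by (simp add: F_eq_symmetrization4 polarization4[of quartic_defect, OF quartic_defect_additive])
  next
    assume "\<forall>x y z w. F mu alpha x y z w = 0"
    then have "scale 24 (quartic_defect x x x x) = 0" for x
      by (simp only: F_eq_symmetrization4 symmetrization4_diagonal[symmetric])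
    then show "\<forall>x. quartic_defect x x x x = 0"
      by simp
  qed
  then show ?thesis
    by (simp only: quartic_defect_diagonal)
qed

end
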